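(* Let $0\to V\to\widehat A\xrightarrow{p}A\to0$ be an abelian extension of an associative 2-algebra $(A;d,\cdot,l_3)$ by $V$, where $\widehat A$ has structure $(\widehat d,\widehat\cdot,\widehat l_3)$, and let $\sigma=(\sigma_0,\sigma_1)$ be a splitting of $p$ (write $\sigma$ for both components). Define for $x,y,z\in A_0$, $a\in A_1$ $$\psi(a)=\widehat d\sigma(a)-\sigma(da),\quad \omega(x,y)=\sigma(x)\,\widehat\cdot\,\sigma(y)-\sigma(x\cdot y),\quad \mu(x,a)=\sigma(x)\,\widehat\cdot\,\sigma(a)-\sigma(x\cdot a),$$ $$\nu(a,x)=\sigma(a)\,\widehat\cdot\,\sigma(x)-\sigma(a\cdot x),\quad \theta(x,y,z)=\widehat l_3(\sigma(x),\sigma(y),\sigma(z))-\sigma(l_3(x,y,z)).$$ Then $(\psi,\omega,\mu,\nu,\theta)$ is a 2-cocycle of $A$ with coefficients in $V$, where $V$ carries the structure maps induced by the extension.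
   Context: All vector spaces are over a fixed field. An associative 2-algebra $A=A_1\oplus A_0$, written $(A;d,\cdot,l_3)$, consists of a linear map $d:A_1\to A_0$, bilinear products $A_i\otimes A_j\to A_{i+j}$ for $0\le i+j\le 1$ (all written $\cdot$), and a trilinear map $l_3:A_0\otimes A_0\otimes A_0\to A_1$ such that for all $x,y,z,t\in A_0$, $a,b\in A_1$: (a) $d(x\cdot a)=x\cdot da$; (b) $d(a\cdot x)=da\cdot x$; (c) $da\cdot b=a\cdot db$; (d) $d\,l_3(x,y,z)=(x\cdot y)\cdot z-x\cdot(y\cdot z)$; (e1) $l_3(x,y,da)=(x\cdot y)\cdot a-x\cdot(y\cdot a)$; (e2) $l_3(x,da,y)=(x\cdot a)\cdot y-x\cdot(a\cdot y)$; (e3) $l_3(da,x,y)=(a\cdot x)\cdot y-a\cdot(x\cdot y)$; (f) $x\cdot l_3(y,z,t)+l_3(x,y,z)\cdot t=l_3(x\cdot y,z,t)-l_3(x,y\cdot z,t)+l_3(x,y,z\cdot t)$. A strict homomorphism of associative 2-algebras is a pair of linear maps $F_0:A_0\to A_0'$, $F_1:A_1\to A_1'$ commuting with differentials, products and $l_3$. Extensions. An extension of $A$ by $V$ is a short exact sequence $0\to V\xrightarrow{i}\widehat A\xrightarrow{p}A\to0$ of associative 2-algebras and strict homomorphisms ($\mathrm{Im}(i)=\mathrm{Ker}(p)$, $\mathrm{Ker}(i)=0$, $\mathrm{Im}(p)=A$); $V=(V_1\xrightarrow{d_V}V_0)$ is regarded as a subcomplex of $\widehat A$ via $i$. It is an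 abelian extension if $V$ is abelian, i.e. the product of $V$ is zero and $l_3$ of $V$ is zero. A splitting $\sigma$ of $p$ is a pair of linear maps $\sigma_0:A_0\to\widehat A_0$, $\sigma_1:A_1\to\widehat A_1$ with $p_0\sigma_0=\mathrm{id}$, $p_1\sigma_1=\mathrm{id}$. The structure maps on $V$ (representation of $A$) induced by an abelian extension are given, for $x,y\in A_0$, $a\in A_1$, $u\in V_0$, $m\in V_1$, by $x\triangleright u=\sigma(x)\,\widehat\cdot\,u$, $x\triangleright m=\sigma(x)\,\widehat\cdot\,m$, $u\triangleleft x=u\,\widehat\cdot\,\sigma(x)$, $m\triangleleft x=m\,\widehat\cdot\,\sigma(x)$, $a\triangleright u=\sigma(a)\,\widehat\cdot\,u\in V_1$, $u\triangleleft a=u\,\widehat\cdot\,\sigma(a)\in V_1$, and the $V_1$-valued trilinear maps $[x,y,u]=\widehat l_3(\sigma(x),\sigma(y),u)$, $[x,u,y]=\widehat l_3(\sigma(x),u,\sigma(y))$, $[u,x,y]=\widehat l_3(u,\sigma(x),\sigma(y))$. 2-cocycles. For linear maps $\psi:A_1\to V_0$, $\omega:A_0\otimes A_0\to V_0$, $\mu:A_0\otimes A_1\to V_1$, $\nu:A_1\otimes A_0\to V_1$, $\theta:A_0^{\otimes3}\to V_1$, the tuple $(\psi,\omega,\mu,\nu,\theta)$ is a 2-cocycle of $A$ with coefficients in $V$ if for all $x,y,z,t\in A_0$, $a,b\in A_1$: (1) $x\triangleright\psi(a)-\psi(x\cdot a)+\omega(x,da)-d_V\mu(x,a)=0$; (2)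 $\psi(a)\triangleleft x-\psi(a\cdot x)+\omega(da,x)-d_V\nu(a,x)=0$; (3) $a\triangleright\psi(b)+\nu(a,db)-\psi(a)\triangleleft b-\mu(da,b)=0$; (4) $\omega(x,y)\triangleleft z-x\triangleright\omega(y,z)+\omega(x\cdot y,z)-\omega(x,y\cdot z)=d_V\theta(x,y,z)+\psi(l_3(x,y,z))$; (5) $\omega(x,y)\triangleleft a-x\triangleright\mu(y,a)+\mu(x\cdot y,a)-\mu(x,y\cdot a)=\theta(x,y,da)+[x,y,\psi(a)]$; (6) $\mu(x,a)\triangleleft y-x\triangleright\nu(a,y)+\nu(x\cdot a,y)-\mu(x,a\cdot y)=\theta(x,da,y)+[x,\psi(a),y]$; (7) $\nu(a,x)\triangleleft y-a\triangleright\omega(x,y)+\nu(a\cdot x,y)-\nu(a,x\cdot y)=\theta(da,x,y)+[\psi(a),x,y]$; (8) $x\triangleright\theta(y,z,t)+\theta(x,y,z)\triangleleft t-\theta(x\cdot y,z,t)+\theta(x,y\cdot z,t)-\theta(x,y,z\cdot t)=\mu(x,l_3(y,z,t))+\nu(l_3(x,y,z),t)-[x,y,\omega(z,t)]-[\omega(x,y),z,t]+[x,\omega(y,z),t]$.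
   Formalization: In cocycle equation (8) the right-hand side is taken with the opposite sign: as printed, (8) fails for some abelian extensions in characteristic other than 2; equations (1)–(7) are as printed. *)

theory Defs
  imports Complex_Main
begin

text \<open>
  Vector spaces over a field \<open>'k\<close> are types of class \<open>ab_group_add\<close> carrying a scalar
  multiplication that satisfies the library locale \<^locale>\<open>vector_space\<close>.
\<close>

definition bilinear_map ::
  "('k::field \<Rightarrow> 'a::ab_group_add \<Rightarrow> 'a) \<Rightarrow> ('k \<Rightarrow> 'b::ab_group_add \<Rightarrow> 'b) \<Rightarrow>
   ('k \<Rightarrow> 'c::ab_group_add \<Rightarrow> 'c) \<Rightarrow> ('a \<Rightarrow> 'b \<Rightarrow> 'c) \<Rightarrow> bool" where
  "bilinear_map sa sb sc f \<longleftrightarrow>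
     (\<forall>y. Vector_Spaces.linear sa sc (\<lambda>x. f x y)) \<and>
     (\<forall>x. Vector_Spaces.linear sb sc (\<lambda>y. f x y))"

definition trilinear_map ::
  "('k::field \<Rightarrow> 'a::ab_group_add \<Rightarrow> 'a) \<Rightarrow> ('k \<Rightarrow> 'b::ab_group_add \<Rightarrow> 'b) \<Rightarrow>
   ('k \<Rightarrow> 'c::ab_group_add \<Rightarrow> 'c) \<Rightarrow> ('k \<Rightarrow> 'd::ab_group_add \<Rightarrow> 'd) \<Rightarrow>
   ('a \<Rightarrow> 'b \<Rightarrow> 'c \<Rightarrow> 'd) \<Rightarrow> bool" where
  "trilinear_map sa sb sc sd f \<longleftrightarrow>
     (\<forall>y z. Vector_Spaces.linear sa sd (\<lambda>x. f x y z)) \<and>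
     (\<forall>x z. Vector_Spaces.linear sb sd (\<lambda>y. f x y z)) \<and>
     (\<forall>x y. Vector_Spaces.linear sc sd (\<lambda>z. f x y z))"


section \<open>Associative 2-algebras\<close>

text \<open>
  The type \<open>'a\<close> is the degree-0 part and \<open>'b\<close> the degree-1 part.  The three products
  of total degree at most 1 are kept apart: \<open>x \<cdot> y\<close> in degree (0,0),
  \<open>x \<cdot>\<^sub>l a\<close> in degree (0,1) and \<open>a \<cdot>\<^sub>r x\<close> in degree (1,0).
\<close>

record ('k, 'a, 'b) two_alg =
  scale0 :: "'k \<Rightarrow> 'a \<Rightarrow> 'a"
  scale1 :: "'k \<Rightarrow> 'b \<Rightarrow> 'b"
  diff :: "'b \<Rightarrow> 'a"
  mul :: "'a \<Rightarrow> 'a \<Rightarrow> 'a"  (infixl "\<cdot>\<index>" 70)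
  lmul :: "'a \<Rightarrow> 'b \<Rightarrow> 'b"  (infixl "\<cdot>\<^sub>l\<index>" 70)
  rmul :: "'b \<Rightarrow> 'a \<Rightarrow> 'b"  (infixl "\<cdot>\<^sub>r\<index>" 70)
  l3 :: "'a \<Rightarrow> 'a \<Rightarrow> 'a \<Rightarrow> 'b"

locale assoc_2alg =
  fixes A :: "('k::field, 'a::ab_group_add, 'b::ab_group_add) two_alg" (structure)
  assumes vs0: "vector_space (scale0 A)"
    and vs1: "vector_space (scale1 A)"
    and diff_linear: "Vector_Spaces.linear (scale1 A) (scale0 A) (diff A)"
    and mul_bilinear: "bilinear_map (scale0 A) (scale0 A) (scale0 A) (mul A)"
    and lmul_bilinear: "bilinear_map (scale0 A) (scale1 A) (scale1 A) (lmul A)"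
    and rmul_bilinear: "bilinear_map (scale1 A) (scale0 A) (scale1 A) (rmul A)"
    and l3_trilinear: "trilinear_map (scale0 A) (scale0 A) (scale0 A) (scale1 A) (l3 A)"
    and diff_lmul: "diff A (x \<cdot>\<^sub>l a) = x \<cdot> diff A a"
    and diff_rmul: "diff A (a \<cdot>\<^sub>r x) = diff A a \<cdot> x"
    and diff_mul_swap: "diff A a \<cdot>\<^sub>l b = a \<cdot>\<^sub>r diff A b"
    and diff_l3: "diff A (l3 A x y z) = (x \<cdot> y) \<cdot> z - x \<cdot> (y \<cdot> z)"
    and l3_diff_right: "l3 A x y (diff A a) = (x \<cdot> y) \<cdot>\<^sub>l a - x \<cdot>\<^sub>l (y \<cdot>\<^sub>l a)"
    and l3_diff_mid: "l3 A x (diff A a) y = (x \<cdot>\<^sub>l a) \<cdot>\<^sub>r y - x \<cdot>\<^sub>l (a \<cdot>\<^sub>r y)"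
    and l3_diff_left: "l3 A (diff A a) x y = (a \<cdot>\<^sub>r x) \<cdot>\<^sub>r y - a \<cdot>\<^sub>r (x \<cdot> y)"
    and l3_pentagon: "x \<cdot>\<^sub>l l3 A y z t + l3 A x y z \<cdot>\<^sub>r t =
           l3 A (x \<cdot> y) z t - l3 A x (y \<cdot> z) t + l3 A x y (z \<cdot> t)"

locale strict_hom =
  source: assoc_2alg A + target: assoc_2alg B
  for A :: "('k::field, 'a::ab_group_add, 'b::ab_group_add) two_alg"
    and B :: "('k, 'c::ab_group_add, 'd::ab_group_add) two_alg" +
  fixes F0 :: "'a \<Rightarrow> 'c" and F1 :: "'b \<Rightarrow> 'd"
  assumes linear0: "Vector_Spaces.linear (scale0 A) (scale0 B) F0"
    and linear1: "Vector_Spaces.linear (scale1 A) (scale1 B) F1"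
    and hom_diff: "F0 (diff A a) = diff B (F1 a)"
    and hom_mul: "F0 (x \<cdot>\<^bsub>A\<^esub> y) = F0 x \<cdot>\<^bsub>B\<^esub> F0 y"
    and hom_lmul: "F1 (x \<cdot>\<^sub>l\<^bsub>A\<^esub> a) = F0 x \<cdot>\<^sub>l\<^bsub>B\<^esub> F1 a"
    and hom_rmul: "F1 (a \<cdot>\<^sub>r\<^bsub>A\<^esub> x) = F1 a \<cdot>\<^sub>r\<^bsub>B\<^esub> F0 x"
    and hom_l3: "F1 (l3 A x y z) = l3 B (F0 x) (F0 y) (F0 z)"


section \<open>Abelian extensions and splittings\<close>

text \<open>The sequence is \<open>0 \<rightarrow> V \<rightarrow> E \<rightarrow> A \<rightarrow> 0\<close>, so \<open>E\<close> is the algebra written with a hat.\<close>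

locale extension_2alg =
  i: strict_hom V E i0 i1 + p: strict_hom E A p0 p1
  for A :: "('k::field, 'a0::ab_group_add, 'a1::ab_group_add) two_alg"
    and V :: "('k, 'v0::ab_group_add, 'v1::ab_group_add) two_alg"
    and E :: "('k, 'e0::ab_group_add, 'e1::ab_group_add) two_alg"
    and i0 :: "'v0 \<Rightarrow> 'e0" and i1 :: "'v1 \<Rightarrow> 'e1"
    and p0 :: "'e0 \<Rightarrow> 'a0" and p1 :: "'e1 \<Rightarrow> 'a1" +
  assumes ker_i0: "{u. i0 u = 0} = {0}" and ker_i1: "{m. i1 m = 0} = {0}"
    and exact0: "range i0 = {e. p0 e = 0}" and exact1: "range i1 = {e. p1 e = 0}"
    and surj_p0: "range p0 = UNIV" and surj_p1: "range p1 = UNIV"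

locale abelian_extension = extension_2alg +
  assumes V_mul: "u \<cdot>\<^bsub>V\<^esub> v = 0"
    and V_lmul: "u \<cdot>\<^sub>l\<^bsub>V\<^esub> m = 0"
    and V_rmul: "m \<cdot>\<^sub>r\<^bsub>V\<^esub> u = 0"
    and V_l3: "l3 V u v w = 0"

definition is_splitting ::
  "('k::field, 'a0::ab_group_add, 'a1::ab_group_add) two_alg \<Rightarrow>
   ('k, 'e0::ab_group_add, 'e1::ab_group_add) two_alg \<Rightarrow>
   ('e0 \<Rightarrow> 'a0) \<Rightarrow> ('e1 \<Rightarrow> 'a1) \<Rightarrow> ('a0 \<Rightarrow> 'e0) \<Rightarrow> ('a1 \<Rightarrow> 'e1) \<Rightarrow> bool" where
  "is_splitting A E p0 p1 s0 s1 \<longleftrightarrow>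
     Vector_Spaces.linear (scale0 A) (scale0 E) s0 \<and>
     Vector_Spaces.linear (scale1 A) (scale1 E) s1 \<and>
     p0 \<circ> s0 = id \<and> p1 \<circ> s1 = id"


section \<open>Structure maps on V\<close>

text \<open>
  Actions of elements of degree (0,0), (0,1), (1,0) of \<open>A\<close> and \<open>V\<close> from the left
  (\<open>lact00\<close>, \<open>lact01\<close>, \<open>lact10\<close>) and from the right (\<open>ract00\<close>, \<open>ract10\<close>, \<open>ract01\<close>);
  in \<open>ractij\<close> the index \<open>i\<close> is the degree of the \<open>V\<close>-argument, which comes first.
  The brackets are indexed by the position of their \<open>V\<close>-argument.
\<close>

record ('a0, 'a1, 'v0, 'v1) structure_maps =
  lact00 :: "'a0 \<Rightarrow> 'v0 \<Rightarrow> 'v0"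
  lact01 :: "'a0 \<Rightarrow> 'v1 \<Rightarrow> 'v1"
  lact10 :: "'a1 \<Rightarrow> 'v0 \<Rightarrow> 'v1"
  ract00 :: "'v0 \<Rightarrow> 'a0 \<Rightarrow> 'v0"
  ract10 :: "'v1 \<Rightarrow> 'a0 \<Rightarrow> 'v1"
  ract01 :: "'v0 \<Rightarrow> 'a1 \<Rightarrow> 'v1"
  brk1 :: "'v0 \<Rightarrow> 'a0 \<Rightarrow> 'a0 \<Rightarrow> 'v1"
  brk2 :: "'a0 \<Rightarrow> 'v0 \<Rightarrow> 'a0 \<Rightarrow> 'v1"
  brk3 :: "'a0 \<Rightarrow> 'a0 \<Rightarrow> 'v0 \<Rightarrow> 'v1"

text \<open>
  Since \<open>V\<close> is identified with its image in \<open>E\<close>, elements of \<open>E\<close> lying in that image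
  are transported back along the inverse of the injections \<open>i0\<close>, \<open>i1\<close>.  That all
  values to which these inverses are applied do lie in the image is
  \<open>induced_maps_in_V\<close> and \<open>cochains_in_V\<close> below.
\<close>

definition induced_maps ::
  "('k, 'e0, 'e1) two_alg \<Rightarrow> ('v0 \<Rightarrow> 'e0) \<Rightarrow> ('v1 \<Rightarrow> 'e1) \<Rightarrow>
   ('a0 \<Rightarrow> 'e0) \<Rightarrow> ('a1 \<Rightarrow> 'e1) \<Rightarrow> ('a0, 'a1, 'v0, 'v1) structure_maps" where
  "induced_maps E i0 i1 s0 s1 = \<lparr>
     lact00 = (\<lambda>x u. inv i0 (s0 x \<cdot>\<^bsub>E\<^esub> i0 u)),
     lact01 = (\<lambda>x m. inv i1 (s0 x \<cdot>\<^sub>l\<^bsub>E\<^esub> i1 m)),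
     lact10 = (\<lambda>a u. inv i1 (s1 a \<cdot>\<^sub>r\<^bsub>E\<^esub> i0 u)),
     ract00 = (\<lambda>u x. inv i0 (i0 u \<cdot>\<^bsub>E\<^esub> s0 x)),
     ract10 = (\<lambda>m x. inv i1 (i1 m \<cdot>\<^sub>r\<^bsub>E\<^esub> s0 x)),
     ract01 = (\<lambda>u a. inv i1 (i0 u \<cdot>\<^sub>l\<^bsub>E\<^esub> s1 a)),
     brk1 = (\<lambda>u x y. inv i1 (l3 E (i0 u) (s0 x) (s0 y))),
     brk2 = (\<lambda>x u y. inv i1 (l3 E (s0 x) (i0 u) (s0 y))),
     brk3 = (\<lambda>x y u. inv i1 (l3 E (s0 x) (s0 y) (i0 u))) \<rparr>"


section \<open>2-cocycles\<close>

text \<open>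
  On the sign in \<open>cocycle_theta\<close>: expanding the pentagon identity \<open>l3_pentagon\<close> of \<open>E\<close>
  on elements \<open>\<sigma>(x), \<sigma>(y), \<sigma>(z), \<sigma>(t)\<close> forces the right-hand side below.  The source
  prints the negative of this right-hand side.  With that sign the cochain of an extension
  is in general not a cocycle in characteristic other than 2.  Example: let \<open>A\<close> have
  basis \<open>e\<close> (degree 0), \<open>a\<close> (degree 1), with \<open>l3(e,e,e) = a\<close> and all else zero; let
  \<open>V\<close> have basis \<open>m, n\<close> (degree 1); on the direct sum put \<open>e \<cdot> m = n\<close>,
  \<open>e \<cdot> a = - n\<close>, \<open>l3(e,e,e) = a + m\<close> and all else zero.  For the obvious splitting,
  \<open>e \<triangleright> \<theta>(e,e,e) = n\<close> and \<open>\<mu>(e, l3(e,e,e)) = - n\<close>, and the other terms vanish.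
\<close>

locale two_cocycle =
  fixes A :: "('k::field, 'a0::ab_group_add, 'a1::ab_group_add) two_alg" (structure)
    and V :: "('k, 'v0::ab_group_add, 'v1::ab_group_add) two_alg"
    and R :: "('a0, 'a1, 'v0, 'v1) structure_maps"
    and \<psi> :: "'a1 \<Rightarrow> 'v0"
    and \<omega> :: "'a0 \<Rightarrow> 'a0 \<Rightarrow> 'v0"
    and \<mu> :: "'a0 \<Rightarrow> 'a1 \<Rightarrow> 'v1"
    and \<nu> :: "'a1 \<Rightarrow> 'a0 \<Rightarrow> 'v1"
    and \<theta> :: "'a0 \<Rightarrow> 'a0 \<Rightarrow> 'a0 \<Rightarrow> 'v1"
  assumes psi_linear: "Vector_Spaces.linear (scale1 A) (scale0 V) \<psi>"
    and omega_bilinear: "bilinear_map (scale0 A) (scale0 A) (scale0 V) \<omega>"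
    and mu_bilinear: "bilinear_map (scale0 A) (scale1 A) (scale1 V) \<mu>"
    and nu_bilinear: "bilinear_map (scale1 A) (scale0 A) (scale1 V) \<nu>"
    and theta_trilinear: "trilinear_map (scale0 A) (scale0 A) (scale0 A) (scale1 V) \<theta>"
    and cocycle_psi_left:
      "lact00 R x (\<psi> a) - \<psi> (x \<cdot>\<^sub>l a) + \<omega> x (diff A a) - diff V (\<mu> x a) = 0"
    and cocycle_psi_right:
      "ract00 R (\<psi> a) x - \<psi> (a \<cdot>\<^sub>r x) + \<omega> (diff A a) x - diff V (\<nu> a x) = 0"
    and cocycle_psi_swap:
      "lact10 R a (\<psi> b) + \<nu> a (diff A b) - ract01 R (\<psi> a) b - \<mu> (diff A a) b = 0"
    and cocycle_omega:
      "ract00 R (\<omega> x y) z - lact00 R x (\<omega> y z) + \<omega> (x \<cdot> y) z - \<omega> x (y \<cdot> z) =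
         diff V (\<theta> x y z) + \<psi> (l3 A x y z)"
    and cocycle_mu:
      "ract01 R (\<omega> x y) a - lact01 R x (\<mu> y a) + \<mu> (x \<cdot> y) a - \<mu> x (y \<cdot>\<^sub>l a) =
         \<theta> x y (diff A a) + brk3 R x y (\<psi> a)"
    and cocycle_mu_nu:
      "ract10 R (\<mu> x a) y - lact01 R x (\<nu> a y) + \<nu> (x \<cdot>\<^sub>l a) y - \<mu> x (a \<cdot>\<^sub>r y) =
         \<theta> x (diff A a) y + brk2 R x (\<psi> a) y"
    and cocycle_nu:
      "ract10 R (\<nu> a x) y - lact10 R a (\<omega> x y) + \<nu> (a \<cdot>\<^sub>r x) y - \<nu> a (x \<cdot> y) =
         \<theta> (diff A a) x y + brk1 R (\<psi> a) x y"
    and cocycle_theta: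
      "lact01 R x (\<theta> y z t) + ract10 R (\<theta> x y z) t
         - \<theta> (x \<cdot> y) z t + \<theta> x (y \<cdot> z) t - \<theta> x y (z \<cdot> t) =
       - (\<mu> x (l3 A y z t) + \<nu> (l3 A x y z) t
          - brk3 R x y (\<omega> z t) - brk1 R (\<omega> x y) z t + brk2 R x (\<omega> y z) t)"


section \<open>The cochain of an extension with splitting\<close>

definition ext_psi where
  "ext_psi A E i0 s0 s1 = (\<lambda>a. inv i0 (diff E (s1 a) - s0 (diff A a)))"

definition ext_omega where
  "ext_omega A E i0 s0 = (\<lambda>x y. inv i0 (s0 x \<cdot>\<^bsub>E\<^esub> s0 y - s0 (x \<cdot>\<^bsub>A\<^esub> y)))"

definition ext_mu where
  "ext_mu A E i1 s0 s1 = (\<lambda>x a. inv i1 (s0 x \<cdot>\<^sub>l\<^bsub>E\<^esub> s1 a - s1 (x \<cdot>\<^sub>l\<^bsub>A\<^esub> a)))"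

definition ext_nu where
  "ext_nu A E i1 s0 s1 = (\<lambda>a x. inv i1 (s1 a \<cdot>\<^sub>r\<^bsub>E\<^esub> s0 x - s1 (a \<cdot>\<^sub>r\<^bsub>A\<^esub> x)))"

definition ext_theta where
  "ext_theta A E i1 s0 s1 =
     (\<lambda>x y z. inv i1 (l3 E (s0 x) (s0 y) (s0 z) - s1 (l3 A x y z)))"


section \<open>The transported elements lie in the image of V\<close>

lemma bilinear_map_zero:
  assumes "bilinear_map sa sb sc f"
  shows "f 0 y = 0" "f x 0 = 0"
proof -
  interpret l: Vector_Spaces.linear sa sc "\<lambda>x. f x y"
    using assms by (simp add: bilinear_map_def)
  interpret r: Vector_Spaces.linear sb sc "\<lambda>y. f x y"
    using assms by (simp add: bilinear_map_def)
  show "f 0 y = 0" "f x 0 = 0" using l.zero r.zero by simp_all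
qed

lemma trilinear_map_zero:
  assumes "trilinear_map sa sb sc sd f"
  shows "f 0 y z = 0" "f x 0 z = 0" "f x y 0 = 0"
proof -
  interpret l: Vector_Spaces.linear sa sd "\<lambda>x. f x y z"
    using assms by (simp add: trilinear_map_def)
  interpret m: Vector_Spaces.linear sb sd "\<lambda>y. f x y z"
    using assms by (simp add: trilinear_map_def)
  interpret r: Vector_Spaces.linear sc sd "\<lambda>z. f x y z"
    using assms by (simp add: trilinear_map_def)
  show "f 0 y z = 0" "f x 0 z = 0" "f x y 0 = 0" using l.zero m.zero r.zero by simp_all
qed

context abelian_extension
begin

lemma p0_diff: "p0 (x - y) = p0 x - p0 y"
proof -
  interpret Vector_Spaces.linear "scale0 E" "scale0 A" p0 by (rule p.linear0)
  show ?thesis by (rule diff)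
qed

lemma p1_diff: "p1 (x - y) = p1 x - p1 y"
proof -
  interpret Vector_Spaces.linear "scale1 E" "scale1 A" p1 by (rule p.linear1)
  show ?thesis by (rule diff)
qed

lemma i0_inv: "p0 e = 0 \<Longrightarrow> i0 (inv i0 e) = e"
  using exact0 by (auto intro: f_inv_into_f)

lemma i1_inv: "p1 e = 0 \<Longrightarrow> i1 (inv i1 e) = e"
  using exact1 by (auto intro: f_inv_into_f)

lemma p0_i0: "p0 (i0 u) = 0" and p1_i1: "p1 (i1 m) = 0"
  using exact0 exact1 by blast+

lemmas p_simps = p0_diff p1_diff p0_i0 p1_i1 p.hom_mul p.hom_lmul p.hom_rmul p.hom_l3
  p.hom_diff[symmetric]
  bilinear_map_zero[OF p.target.mul_bilinear] bilinear_map_zero[OF p.target.lmul_bilinear]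
  bilinear_map_zero[OF p.target.rmul_bilinear] trilinear_map_zero[OF p.target.l3_trilinear]

lemma induced_maps_in_V:
  fixes s0 s1 defines "R \<equiv> induced_maps E i0 i1 s0 s1"
  shows "i0 (lact00 R x u) = s0 x \<cdot>\<^bsub>E\<^esub> i0 u"
    and "i1 (lact01 R x m) = s0 x \<cdot>\<^sub>l\<^bsub>E\<^esub> i1 m"
    and "i1 (lact10 R a u) = s1 a \<cdot>\<^sub>r\<^bsub>E\<^esub> i0 u"
    and "i0 (ract00 R u x) = i0 u \<cdot>\<^bsub>E\<^esub> s0 x"
    and "i1 (ract10 R m x) = i1 m \<cdot>\<^sub>r\<^bsub>E\<^esub> s0 x"
    and "i1 (ract01 R u a) = i0 u \<cdot>\<^sub>l\<^bsub>E\<^esub> s1 a"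
    and "i1 (brk1 R u x y) = l3 E (i0 u) (s0 x) (s0 y)"
    and "i1 (brk2 R x u y) = l3 E (s0 x) (i0 u) (s0 y)"
    and "i1 (brk3 R x y u) = l3 E (s0 x) (s0 y) (i0 u)"
  unfolding R_def induced_maps_def by (simp_all add: i0_inv i1_inv p_simps)

lemma cochains_in_V:
  assumes "is_splitting A E p0 p1 s0 s1"
  shows "i0 (ext_psi A E i0 s0 s1 a) = diff E (s1 a) - s0 (diff A a)"
    and "i0 (ext_omega A E i0 s0 x y) = s0 x \<cdot>\<^bsub>E\<^esub> s0 y - s0 (x \<cdot>\<^bsub>A\<^esub> y)"
    and "i1 (ext_mu A E i1 s0 s1 x a) = s0 x \<cdot>\<^sub>l\<^bsub>E\<^esub> s1 a - s1 (x \<cdot>\<^sub>l\<^bsub>A\<^esub> a)"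
    and "i1 (ext_nu A E i1 s0 s1 a x) = s1 a \<cdot>\<^sub>r\<^bsub>E\<^esub> s0 x - s1 (a \<cdot>\<^sub>r\<^bsub>A\<^esub> x)"
    and "i1 (ext_theta A E i1 s0 s1 x y z) =
           l3 E (s0 x) (s0 y) (s0 z) - s1 (l3 A x y z)"
proof -
  have s: "p0 (s0 x) = x" "p1 (s1 a) = a" for x a
    using assms by (auto simp: is_splitting_def fun_eq_iff)
  have d: "p0 (diff E e) = diff A (p1 e)" for e by (rule p.hom_diff)
  show "i0 (ext_psi A E i0 s0 s1 a) = diff E (s1 a) - s0 (diff A a)"
    unfolding ext_psi_def by (rule i0_inv) (simp add: p0_diff d s)
  show "i0 (ext_omega A E i0 s0 x y) = s0 x \<cdot>\<^bsub>E\<^esub> s0 y - s0 (x \<cdot>\<^bsub>A\<^esub> y)"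
    and "i1 (ext_mu A E i1 s0 s1 x a) = s0 x \<cdot>\<^sub>l\<^bsub>E\<^esub> s1 a - s1 (x \<cdot>\<^sub>l\<^bsub>A\<^esub> a)"
    and "i1 (ext_nu A E i1 s0 s1 a x) = s1 a \<cdot>\<^sub>r\<^bsub>E\<^esub> s0 x - s1 (a \<cdot>\<^sub>r\<^bsub>A\<^esub> x)"
    and "i1 (ext_theta A E i1 s0 s1 x y z) =
           l3 E (s0 x) (s0 y) (s0 z) - s1 (l3 A x y z)"
    by (simp_all add: ext_omega_def ext_mu_def ext_nu_def ext_theta_def i0_inv i1_inv
        p_simps s)
qed

end

end

theory Submission
  imports Defs
begin

text \<open>
  The maps \<open>i0\<close> and \<open>i1\<close> are injective and linear, so an identity in \<open>V\<close> may be checked after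
  applying them, that is, inside \<open>E\<close>.  There the structure maps are products and values of \<open>l3\<close> in
  \<open>E\<close> (\<open>induced_maps_in_V\<close>) and each cochain is the defect of \<open>\<sigma>\<close> with respect to one structure
  operation (\<open>cochains_in_V\<close>).  Expanding by multilinearity, all mixed terms such as
  \<open>\<sigma>(x) \<cdot> \<sigma>(y \<cdot> a)\<close> cancel, and what is left of each cocycle identity is the corresponding axiom of
  \<open>E\<close>, evaluated on \<open>\<sigma>(x), \<sigma>(a), \<dots>\<close>, minus the image under \<open>\<sigma>\<close> of the same axiom of \<open>A\<close>.
  Linearity of the cochains is also checked inside \<open>E\<close> (\<open>linear_reflect\<close>).
\<close>

lemma linear_additive:
  assumes "Vector_Spaces.linear sa sb f"
  shows "f (x + y) = f x + f y" "f (x - y) = f x - f y" "f (- x) = - f x" "f 0 = 0"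
proof -
  interpret Vector_Spaces.linear sa sb f by (rule assms)
  show "f (x + y) = f x + f y" "f (x - y) = f x - f y" "f (- x) = - f x" "f 0 = 0"
    by (rule add diff neg zero)+
qed

lemma linear_scale:
  assumes "Vector_Spaces.linear sa sb f"
  shows "f (sa c x) = sb c (f x)"
  using assms by (rule module_hom.scale[OF Vector_Spaces.linear.axioms(3)])

lemma linear_difference:
  assumes "Vector_Spaces.linear sa sb f" "Vector_Spaces.linear sa sb g"
  shows "Vector_Spaces.linear sa sb (\<lambda>x. f x - g x)"
proof -
  interpret vector_space_pair sa sb
    using assms(1) by (simp add: Vector_Spaces.linear_def vector_space_pair_def)
  show ?thesis by (rule linear_compose_sub[OF assms])
qed

lemma linear_comp:
  assumes "Vector_Spaces.linear sb sc g" "Vector_Spaces.linear sa sb f"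
  shows "Vector_Spaces.linear sa sc (\<lambda>x. g (f x))"
  using Vector_Spaces.linear_compose[OF assms(2,1)] by (simp add: comp_def)

text \<open>A map into \<open>V\<close> is linear as soon as it is linear after composition with an injective
  linear map; this replaces any discussion of the linearity of \<open>inv i0\<close> and \<open>inv i1\<close>.\<close>

lemma linear_reflect:
  assumes i: "Vector_Spaces.linear sv se i" and "inj i"
    and f: "Vector_Spaces.linear sa se (\<lambda>x. i (f x))"
  shows "Vector_Spaces.linear sa sv f"
proof -
  have "vector_space sa" "vector_space sv"
    using i f by (simp_all add: Vector_Spaces.linear_def)
  moreover have "f (x + y) = f x + f y" for x y
    by (rule injD[OF \<open>inj i\<close>]) (simp add: linear_additive[OF i] linear_additive[OF f])
  moreover have "f (sa c x) = sv c (f x)" for c x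
    by (rule injD[OF \<open>inj i\<close>]) (simp add: linear_scale[OF i] linear_scale[OF f])
  ultimately show ?thesis
    by (simp add: Vector_Spaces.linear_iff)
qed

lemma bilinear_map_linear:
  assumes "bilinear_map sa sb sc f"
  shows "Vector_Spaces.linear sa sc (\<lambda>x. f x y)" "Vector_Spaces.linear sb sc (f x)"
  using assms by (simp_all add: bilinear_map_def)

lemma trilinear_map_linear:
  assumes "trilinear_map sa sb sc sd f"
  shows "Vector_Spaces.linear sa sd (\<lambda>x. f x y z)"
    "Vector_Spaces.linear sb sd (\<lambda>y. f x y z)" "Vector_Spaces.linear sc sd (f x y)"
  using assms by (simp_all add: trilinear_map_def)

lemma bilinear_map_diff:
  assumes "bilinear_map sa sb sc f"
  shows "f (x - x') y = f x y - f x' y" "f x (y - y') = f x y - f x y'"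
  by (rule bilinear_map_linear[OF assms, THEN linear_additive(2)])+

lemma trilinear_map_diff:
  assumes "trilinear_map sa sb sc sd f"
  shows "f (x - x') y z = f x y z - f x' y z" "f x (y - y') z = f x y z - f x y' z"
    "f x y (z - z') = f x y z - f x y z'"
  by (rule trilinear_map_linear[OF assms, THEN linear_additive(2)])+

text \<open>An abelian extension with a chosen splitting \<open>\<sigma> = (s0, s1)\<close>; the induced structure maps and
  cochain are abbreviated by the letters of the cocycle identities.\<close>

locale split_abelian_extension = abelian_extension A V E i0 i1 p0 p1
  for A :: "('k::field, 'a0::ab_group_add, 'a1::ab_group_add) two_alg"
    and V :: "('k, 'v0::ab_group_add, 'v1::ab_group_add) two_alg"
    and E :: "('k, 'e0::ab_group_add, 'e1::ab_group_add) two_alg"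
    and i0 :: "'v0 \<Rightarrow> 'e0" and i1 :: "'v1 \<Rightarrow> 'e1"
    and p0 :: "'e0 \<Rightarrow> 'a0" and p1 :: "'e1 \<Rightarrow> 'a1" +
  fixes s0 :: "'a0 \<Rightarrow> 'e0" and s1 :: "'a1 \<Rightarrow> 'e1"
  assumes splitting: "is_splitting A E p0 p1 s0 s1"
begin

abbreviation "R \<equiv> induced_maps E i0 i1 s0 s1"
abbreviation "\<psi> \<equiv> ext_psi A E i0 s0 s1"
abbreviation "\<omega> \<equiv> ext_omega A E i0 s0"
abbreviation "\<mu> \<equiv> ext_mu A E i1 s0 s1"
abbreviation "\<nu> \<equiv> ext_nu A E i1 s0 s1"
abbreviation "\<theta> \<equiv> ext_theta A E i1 s0 s1"

lemma s0_linear: "Vector_Spaces.linear (scale0 A) (scale0 E) s0"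
  and s1_linear: "Vector_Spaces.linear (scale1 A) (scale1 E) s1"
  using splitting by (simp_all add: is_splitting_def)

lemma inj_i0: "inj i0"
proof (rule injI)
  fix u v assume "i0 u = i0 v"
  then have "i0 (u - v) = 0" by (simp add: linear_additive[OF i.linear0])
  then show "u = v" using ker_i0 by (simp add: set_eq_iff)
qed

lemma inj_i1: "inj i1"
proof (rule injI)
  fix m n assume "i1 m = i1 n"
  then have "i1 (m - n) = 0" by (simp add: linear_additive[OF i.linear1])
  then show "m = n" using ker_i1 by (simp add: set_eq_iff)
qed

text \<open>Rules that expand the image in \<open>E\<close> of an expression in the structure maps and the cochain
  into products of values of \<open>\<sigma>\<close>.\<close>

lemmas expand =
  linear_additive[OF i.linear0] linear_additive[OF i.linear1]
  linear_additive[OF s0_linear] linear_additive[OF s1_linear]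
  linear_additive[OF i.target.diff_linear]
  bilinear_map_diff[OF i.target.mul_bilinear] bilinear_map_diff[OF i.target.lmul_bilinear]
  bilinear_map_diff[OF i.target.rmul_bilinear] trilinear_map_diff[OF i.target.l3_trilinear]
  induced_maps_in_V cochains_in_V[OF splitting] i.hom_diff

text \<open>Introduction rules that prove an explicit expression in \<open>E\<close> linear in one of its
  arguments, following the way it is built from \<open>\<sigma>\<close> and the structure operations.\<close>

lemmas linear_intros =
  linear_difference s0_linear s1_linear
  linear_comp[OF s0_linear] linear_comp[OF s1_linear] linear_comp[OF i.target.diff_linear]
  p.target.diff_linear
  bilinear_map_linear[OF p.target.mul_bilinear] bilinear_map_linear[OF p.target.lmul_bilinear]
  bilinear_map_linear[OF p.target.rmul_bilinear] trilinear_map_linear[OF p.target.l3_trilinear]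
  linear_comp[OF bilinear_map_linear(1)[OF i.target.mul_bilinear]]
  linear_comp[OF bilinear_map_linear(2)[OF i.target.mul_bilinear]]
  linear_comp[OF bilinear_map_linear(1)[OF i.target.lmul_bilinear]]
  linear_comp[OF bilinear_map_linear(2)[OF i.target.lmul_bilinear]]
  linear_comp[OF bilinear_map_linear(1)[OF i.target.rmul_bilinear]]
  linear_comp[OF bilinear_map_linear(2)[OF i.target.rmul_bilinear]]
  linear_comp[OF trilinear_map_linear(1)[OF i.target.l3_trilinear]]
  linear_comp[OF trilinear_map_linear(2)[OF i.target.l3_trilinear]]
  linear_comp[OF trilinear_map_linear(3)[OF i.target.l3_trilinear]]

lemma cochain_linear:
  shows "Vector_Spaces.linear (scale1 A) (scale0 V) \<psi>"
    and "bilinear_map (scale0 A) (scale0 A) (scale0 V) \<omega>"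
    and "bilinear_map (scale0 A) (scale1 A) (scale1 V) \<mu>"
    and "bilinear_map (scale1 A) (scale0 A) (scale1 V) \<nu>"
    and "trilinear_map (scale0 A) (scale0 A) (scale0 A) (scale1 V) \<theta>"
  unfolding bilinear_map_def trilinear_map_def
  by (intro conjI allI linear_reflect[OF i.linear0 inj_i0] linear_reflect[OF i.linear1 inj_i1];
      simp only: cochains_in_V[OF splitting]; intro linear_intros)+

lemma psi_identities:
  shows "lact00 R x (\<psi> a) - \<psi> (x \<cdot>\<^sub>l\<^bsub>A\<^esub> a) + \<omega> x (diff A a) - diff V (\<mu> x a) = 0"
    and "ract00 R (\<psi> a) x - \<psi> (a \<cdot>\<^sub>r\<^bsub>A\<^esub> x) + \<omega> (diff A a) x - diff V (\<nu> a x) = 0"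
    and "lact10 R a (\<psi> b) + \<nu> a (diff A b) - ract01 R (\<psi> a) b - \<mu> (diff A a) b = 0"
  by (rule injD[OF inj_i0] injD[OF inj_i1],
      simp add: expand i.target.diff_lmul i.target.diff_rmul i.target.diff_mul_swap
        p.target.diff_lmul p.target.diff_rmul p.target.diff_mul_swap)+

lemma associator_identities:
  shows "ract00 R (\<omega> x y) z - lact00 R x (\<omega> y z) + \<omega> (x \<cdot>\<^bsub>A\<^esub> y) z - \<omega> x (y \<cdot>\<^bsub>A\<^esub> z) =
           diff V (\<theta> x y z) + \<psi> (l3 A x y z)"
    and "ract01 R (\<omega> x y) a - lact01 R x (\<mu> y a) + \<mu> (x \<cdot>\<^bsub>A\<^esub> y) a - \<mu> x (y \<cdot>\<^sub>l\<^bsub>A\<^esub> a) =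
           \<theta> x y (diff A a) + brk3 R x y (\<psi> a)"
    and "ract10 R (\<mu> x a) y - lact01 R x (\<nu> a y) + \<nu> (x \<cdot>\<^sub>l\<^bsub>A\<^esub> a) y - \<mu> x (a \<cdot>\<^sub>r\<^bsub>A\<^esub> y) =
           \<theta> x (diff A a) y + brk2 R x (\<psi> a) y"
    and "ract10 R (\<nu> a x) y - lact10 R a (\<omega> x y) + \<nu> (a \<cdot>\<^sub>r\<^bsub>A\<^esub> x) y - \<nu> a (x \<cdot>\<^bsub>A\<^esub> y) =
           \<theta> (diff A a) x y + brk1 R (\<psi> a) x y"
  by (rule injD[OF inj_i0] injD[OF inj_i1],
      simp add: expand i.target.diff_l3 i.target.l3_diff_right i.target.l3_diff_mid
        i.target.l3_diff_left p.target.diff_l3 p.target.l3_diff_right p.target.l3_diff_mid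
        p.target.l3_diff_left)+

lemma pentagon_identity:
  "lact01 R x (\<theta> y z t) + ract10 R (\<theta> x y z) t
     - \<theta> (x \<cdot>\<^bsub>A\<^esub> y) z t + \<theta> x (y \<cdot>\<^bsub>A\<^esub> z) t - \<theta> x y (z \<cdot>\<^bsub>A\<^esub> t) =
   - (\<mu> x (l3 A y z t) + \<nu> (l3 A x y z) t
      - brk3 R x y (\<omega> z t) - brk1 R (\<omega> x y) z t + brk2 R x (\<omega> y z) t)"
proof (rule injD[OF inj_i1])
  \<comment> \<open>The pentagon axioms of \<open>A\<close> (under \<open>\<sigma>\<close>) and of \<open>E\<close>, each solved for one of its terms so
    that it can be used as a rewrite rule after the expansion.\<close>
  have "s1 (x \<cdot>\<^sub>l\<^bsub>A\<^esub> l3 A y z t) = s1 (l3 A (x \<cdot>\<^bsub>A\<^esub> y) z t) - s1 (l3 A x (y \<cdot>\<^bsub>A\<^esub> z) t)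
      + s1 (l3 A x y (z \<cdot>\<^bsub>A\<^esub> t)) - s1 (l3 A x y z \<cdot>\<^sub>r\<^bsub>A\<^esub> t)"
    using arg_cong[OF p.target.l3_pentagon[of x y z t], of s1]
    by (simp add: linear_additive[OF s1_linear] algebra_simps)
  moreover have "s0 x \<cdot>\<^sub>l\<^bsub>E\<^esub> l3 E (s0 y) (s0 z) (s0 t) =
      l3 E (s0 x \<cdot>\<^bsub>E\<^esub> s0 y) (s0 z) (s0 t) - l3 E (s0 x) (s0 y \<cdot>\<^bsub>E\<^esub> s0 z) (s0 t)
      + l3 E (s0 x) (s0 y) (s0 z \<cdot>\<^bsub>E\<^esub> s0 t) - l3 E (s0 x) (s0 y) (s0 z) \<cdot>\<^sub>r\<^bsub>E\<^esub> s0 t"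
    using i.target.l3_pentagon[of "s0 x" "s0 y" "s0 z" "s0 t"] by (simp add: algebra_simps)
  ultimately show "i1 (lact01 R x (\<theta> y z t) + ract10 R (\<theta> x y z) t
        - \<theta> (x \<cdot>\<^bsub>A\<^esub> y) z t + \<theta> x (y \<cdot>\<^bsub>A\<^esub> z) t - \<theta> x y (z \<cdot>\<^bsub>A\<^esub> t)) =
      i1 (- (\<mu> x (l3 A y z t) + \<nu> (l3 A x y z) t
        - brk3 R x y (\<omega> z t) - brk1 R (\<omega> x y) z t + brk2 R x (\<omega> y z) t))"
    by (simp add: expand)
qed

lemma two_cocycle: "two_cocycle A V R \<psi> \<omega> \<mu> \<nu> \<theta>"
  by (rule two_cocycle.intro)
    (fact cochain_linear psi_identities associator_identities pentagon_identity)+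

end

theorem theorem4p3:
  fixes A :: "('k::field, 'a0::ab_group_add, 'a1::ab_group_add) two_alg"
    and V :: "('k, 'v0::ab_group_add, 'v1::ab_group_add) two_alg"
    and E :: "('k, 'e0::ab_group_add, 'e1::ab_group_add) two_alg"
    and i0 :: "'v0 \<Rightarrow> 'e0" and i1 :: "'v1 \<Rightarrow> 'e1"
    and p0 :: "'e0 \<Rightarrow> 'a0" and p1 :: "'e1 \<Rightarrow> 'a1"
    and s0 :: "'a0 \<Rightarrow> 'e0" and s1 :: "'a1 \<Rightarrow> 'e1"
  assumes "abelian_extension A V E i0 i1 p0 p1"
    and "is_splitting A E p0 p1 s0 s1"
  shows "two_cocycle A V (induced_maps E i0 i1 s0 s1)
           (ext_psi A E i0 s0 s1) (ext_omega A E i0 s0) (ext_mu A E i1 s0 s1)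
           (ext_nu A E i1 s0 s1) (ext_theta A E i1 s0 s1)"
proof -
  interpret split_abelian_extension A V E i0 i1 p0 p1 s0 s1
    using assms by (simp add: split_abelian_extension_def split_abelian_extension_axioms_def)
  show ?thesis by (rule two_cocycle)
qed

end
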